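(* Let $g\in\mathbb N$ and let $k\le g$ be a positive integer. In single-machine non-clairvoyant scheduling of $n$ jobs with Poisson stochastic progress bars of granularity $g$, for every instance and every $\epsilon\in[0,1]$, the Repeated Explore-Then-Commit algorithm with threshold $k$ satisfies $\mathrm{ALG}\le\big(1+3\epsilon+4\frac kg\big)\mathrm{OPT}$ with probability at least $1-2n\exp(-\epsilon^2k/7)$. Consequently, for any fixed $\alpha>0$, in the regime $\frac{\sqrt{\alpha\log n}}{g^{1/3}}<1$, taking $k=g^{2/3}$ gives $\mathrm{ALG}\le\big(1+O\big(\frac{\sqrt{\alpha\log n}}{g^{1/3}}\big)\big)\mathrm{OPT}$ with probability at least $1-O(n^{-\alpha})$.
   Context: Single-machine preemptive scheduling of $n$ jobs available at time $0$ with unknown processing times $p_j>0$, minimizing total completion time $\sum_jC_j$; capacity may be shared arbitrarily among unfinished jobs; $\mathrm{OPT}$ is the optimal value. Stochastic progress bar of granularity $g$: for each job $j$ independently, let $\tilde\beta_j^{(1)}\le\dots\le\tilde\beta_j^{(g)}$ be the first $g$ points of a Poisson point process of rate $g$ on $\mathbb{R}_+$, $\beta_j^{(h)}=\min(1,\tilde\beta_j^{(h)})$, $\beta_j^{(g+1)}=1$, and $\varphi_j(x)=\frac1{g+1}\sum_{h=1}^{g+1}\mathbb{1}(x\ge\beta_j^{(h)})$; the scheduler observes the displayed progress $\varphi_j(e_j/p_j)$ of each job, $e_j$ being its elapsed processing. Repeated Explore-Then-Commit with threshold $k$: maintain the set $\mathcal J$ of unfinished jobs; run Round-Robin (equal sharing)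 on $\mathcal J$; as soon as some $j\in\mathcal J$ has displayed progress at least $k/(g+1)$, run $j$ alone until completion, remove it, and resume Round-Robin. Probabilities are over the progress bars. *)

theory Defs
  imports "HOL-Probability.Probability"
begin

section \<open>Single-machine preemptive scheduling with shared capacity\<close>

text \<open>
  An instance consists of jobs \<open>0, \<dots>, n - 1\<close> with processing times \<open>p j > 0\<close>.
  A schedule \<open>\<sigma>\<close> gives the fraction \<open>\<sigma> j t\<close> of the machine that job \<open>j\<close> receives at time \<open>t\<close>;
  \<open>work \<sigma> j t\<close> is the elapsed processing of \<open>j\<close> up to time \<open>t\<close>.
\<close>

definition work :: "(nat \<Rightarrow> real \<Rightarrow> real) \<Rightarrow> nat \<Rightarrow> real \<Rightarrow> real" where
  "work \<sigma> j t = integral {0..t} (\<sigma> j)"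

definition unfinished :: "nat \<Rightarrow> (nat \<Rightarrow> real) \<Rightarrow> (nat \<Rightarrow> real \<Rightarrow> real) \<Rightarrow> real \<Rightarrow> nat set" where
  "unfinished n p \<sigma> t = {j. j < n \<and> work \<sigma> j t < p j}"

text \<open>Idle time is allowed; a schedule need not complete every job.\<close>

definition schedule :: "nat \<Rightarrow> (nat \<Rightarrow> real) \<Rightarrow> (nat \<Rightarrow> real \<Rightarrow> real) \<Rightarrow> bool" where
  "schedule n p \<sigma> \<longleftrightarrow>
     (\<forall>j<n. \<forall>t\<ge>0. \<sigma> j integrable_on {0..t}) \<and>
     (\<forall>j<n. \<forall>t\<ge>0. 0 \<le> \<sigma> j t) \<and>
     (\<forall>t\<ge>0. (\<Sum>j<n. \<sigma> j t) \<le> 1) \<and>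
     (\<forall>t\<ge>0. \<forall>j<n. j \<notin> unfinished n p \<sigma> t \<longrightarrow> \<sigma> j t = 0)"

definition completes_all :: "nat \<Rightarrow> (nat \<Rightarrow> real) \<Rightarrow> (nat \<Rightarrow> real \<Rightarrow> real) \<Rightarrow> bool" where
  "completes_all n p \<sigma> \<longleftrightarrow> (\<forall>j<n. \<exists>t\<ge>0. p j \<le> work \<sigma> j t)"

definition completion_time :: "(nat \<Rightarrow> real) \<Rightarrow> (nat \<Rightarrow> real \<Rightarrow> real) \<Rightarrow> nat \<Rightarrow> real" where
  "completion_time p \<sigma> j = Inf {t. 0 \<le> t \<and> p j \<le> work \<sigma> j t}"

definition total_completion_time :: "nat \<Rightarrow> (nat \<Rightarrow> real) \<Rightarrow> (nat \<Rightarrow> real \<Rightarrow> real) \<Rightarrow> real" where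
  "total_completion_time n p \<sigma> = (\<Sum>j<n. completion_time p \<sigma> j)"

definition opt :: "nat \<Rightarrow> (nat \<Rightarrow> real) \<Rightarrow> real" where
  "opt n p = Inf {total_completion_time n p \<sigma> | \<sigma>. schedule n p \<sigma> \<and> completes_all n p \<sigma>}"

section \<open>Poisson stochastic progress bars\<close>

text \<open>
  A Poisson point process on the nonnegative reals is represented by the sequence
  \<open>\<tau> \<omega> 0 \<le> \<tau> \<omega> 1 \<le> \<dots>\<close> of its points. Divergence of this sequence is local finiteness;
  it also ensures that \<open>point_count\<close> is never the cardinality of an infinite set for bounded \<open>A\<close>.
\<close>

definition point_count :: "(nat \<Rightarrow> real) \<Rightarrow> real set \<Rightarrow> nat" where
  "point_count x A = card {i. x i \<in> A}"

text \<open>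
  Poisson counts are only required on sets of positive measure because \<open>poisson_pmf\<close> is
  specified for positive rates only; that null sets almost surely contain no point follows.
\<close>

definition poisson_process :: "'w measure \<Rightarrow> real \<Rightarrow> ('w \<Rightarrow> nat \<Rightarrow> real) \<Rightarrow> bool" where
  "poisson_process M rate \<tau> \<longleftrightarrow>
     (\<forall>i. (\<lambda>\<omega>. \<tau> \<omega> i) \<in> borel_measurable M) \<and>
     (AE \<omega> in M. (\<forall>i. 0 \<le> \<tau> \<omega> i) \<and> incseq (\<tau> \<omega>) \<and> filterlim (\<tau> \<omega>) at_top sequentially) \<and>
     (\<forall>A\<in>sets borel. A \<subseteq> {0..} \<and> bounded A \<and> 0 < measure lborel A \<longrightarrow>
        distr M (count_space UNIV) (\<lambda>\<omega>. point_count (\<tau> \<omega>) A)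
          = measure_pmf (poisson_pmf (rate * measure lborel A))) \<and>
     (\<forall>(m::nat) B. disjoint_family_on B {..<m} \<and>
        (\<forall>i<m. B i \<in> sets borel \<and> B i \<subseteq> {0..} \<and> bounded (B i)) \<longrightarrow>
        prob_space.indep_vars M (\<lambda>_. count_space UNIV) (\<lambda>i \<omega>. point_count (\<tau> \<omega>) (B i)) {..<m})"

definition poisson_bars :: "'w measure \<Rightarrow> nat \<Rightarrow> nat \<Rightarrow> (nat \<Rightarrow> 'w \<Rightarrow> nat \<Rightarrow> real) \<Rightarrow> bool" where
  "poisson_bars M n g T \<longleftrightarrow> prob_space M \<and>
     (\<forall>j<n. poisson_process M (real g) (T j)) \<and>
     prob_space.indep_vars M (\<lambda>_. PiM UNIV (\<lambda>_. borel)) T {..<n}"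

text \<open>
  The points are indexed from \<open>0\<close>, the jump positions \<open>bar_jump g x h\<close> of the bar from \<open>1\<close> to \<open>g + 1\<close>.
\<close>

definition bar_jump :: "nat \<Rightarrow> (nat \<Rightarrow> real) \<Rightarrow> nat \<Rightarrow> real" where
  "bar_jump g x h = (if h \<le> g then min 1 (x (h - 1)) else 1)"

definition displayed_progress :: "nat \<Rightarrow> (nat \<Rightarrow> real) \<Rightarrow> real \<Rightarrow> real" where
  "displayed_progress g x y = (\<Sum>h=1..g+1. of_bool (bar_jump g x h \<le> y)) / real (g + 1)"

section \<open>Repeated Explore-Then-Commit\<close>

definition triggered :: "nat \<Rightarrow> (nat \<Rightarrow> real) \<Rightarrow> nat \<Rightarrow> nat \<Rightarrow> (nat \<Rightarrow> nat \<Rightarrow> real) \<Rightarrow>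
    (nat \<Rightarrow> real \<Rightarrow> real) \<Rightarrow> real \<Rightarrow> nat set" where
  "triggered n p g k x \<sigma> t = {j \<in> unfinished n p \<sigma> t.
     real k / real (g + 1) \<le> displayed_progress g (x j) (work \<sigma> j t / p j)}"

text \<open>
  \<open>x j\<close> is the realized point sequence of job \<open>j\<close>. Whenever no unfinished job has reached the
  threshold, the unfinished jobs share the machine equally; otherwise one of the jobs that have
  reached it holds the whole machine from then on until it completes (by the capacity constraint
  of \<open>schedule\<close> no other job runs meanwhile). Between two triggering or completion events the
  condition only restates that the running job keeps running. Ties are broken arbitrarily.
\<close>

definition repeated_etc :: "nat \<Rightarrow> (nat \<Rightarrow> real) \<Rightarrow> nat \<Rightarrow> nat \<Rightarrow> (nat \<Rightarrow> nat \<Rightarrow> real) \<Rightarrow>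
    (nat \<Rightarrow> real \<Rightarrow> real) \<Rightarrow> bool" where
  "repeated_etc n p g k x \<sigma> \<longleftrightarrow> schedule n p \<sigma> \<and>
     (\<forall>t\<ge>0. if triggered n p g k x \<sigma> t = {}
        then \<forall>j\<in>unfinished n p \<sigma> t. \<sigma> j t = 1 / real (card (unfinished n p \<sigma> t))
        else \<exists>j\<in>triggered n p g k x \<sigma> t. \<forall>s\<ge>t. j \<in> unfinished n p \<sigma> s \<longrightarrow> \<sigma> j s = 1)"

text \<open>
  Since tie-breaking may depend on the outcome in a non-measurable way, ``with probability at
  least \<open>q\<close>'' is stated through a measurable event contained in the set of good outcomes.
\<close>

definition with_prob_at_least :: "'w measure \<Rightarrow> real \<Rightarrow> ('w \<Rightarrow> bool) \<Rightarrow> bool" where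
  "with_prob_at_least M q P \<longleftrightarrow> (\<exists>E\<in>sets M. q \<le> measure M E \<and> (\<forall>\<omega>\<in>E. P \<omega>))"

text \<open>\<open>ALG \<le> c \<cdot> OPT\<close>, for every run of the algorithm on the bars realized in \<open>\<omega>\<close>.\<close>

definition etc_competitive :: "nat \<Rightarrow> (nat \<Rightarrow> real) \<Rightarrow> nat \<Rightarrow> nat \<Rightarrow>
    (nat \<Rightarrow> 'w \<Rightarrow> nat \<Rightarrow> real) \<Rightarrow> real \<Rightarrow> 'w \<Rightarrow> bool" where
  "etc_competitive n p g k T c \<omega> \<longleftrightarrow>
     (\<forall>\<sigma>. repeated_etc n p g k (\<lambda>j. T j \<omega>) \<sigma> \<longrightarrow> total_completion_time n p \<sigma> \<le> c * opt n p)"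

end

theory Submission
  imports Defs
begin

text \<open>
  Job \<open>j\<close> reaches the threshold once it has received \<open>q\<^sub>j = min 1 \<beta>\<^sub>j \<cdot> p\<^sub>j\<close> units of work, where
  \<open>\<beta>\<^sub>j\<close> is the \<open>k\<close>-th point of its bar. The machine is never idle, so the cost of a run is
  \<open>\<Sum>\<^sub>j p\<^sub>j\<close> plus the sum over all pairs of jobs of the work that each receives before the other
  one completes. If \<open>j\<close>
  completes first, then \<open>q\<^sub>j \<le> q\<^sub>i\<close> and \<open>i\<close> has received at most \<open>min q\<^sub>i q\<^sub>j\<close> by then, whereas in
  every schedule the pair costs at least \<open>min p\<^sub>i p\<^sub>j\<close>. So if all \<open>\<beta>\<^sub>j\<close> lie in
  \<open>[lo, hi]\<close>, the algorithm is \<open>(hi / lo + hi)\<close>-competitive. A Chernoff bound for the Poisson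
  counts yields such a window with \<open>lo = e\<^sup>-\<^sup>u k / g\<close> and \<open>hi = e\<^sup>u k / g\<close>; the first claim is the
  choice \<open>u = \<epsilon> ln 2\<close>, and in the second one \<open>u\<close> is a constant multiple of
  \<open>sqrt (\<alpha> ln n) / g\<^sup>1\<^sup>/\<^sup>3\<close>, which need not be below \<open>1\<close>.
\<close>

section \<open>Completion times and work\<close>

text \<open>The sublevel set is compact, so it has a last point, and the intermediate value theorem
  rules out \<open>f s < c\<close> there. Choosing the last crossing gives a strict inequality on
  all of the rest of the interval.\<close>

lemma last_crossing:
  fixes f :: "real \<Rightarrow> real"
  assumes cont: "continuous_on {0..t} f" and "0 \<le> t" "f 0 \<le> c" "c < f t"
  obtains s where "0 \<le> s" "s < t" "f s = c" "\<And>r. s < r \<Longrightarrow> r \<le> t \<Longrightarrow> c < f r"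
proof -
  let ?S = "{r \<in> {0..t}. f r \<le> c}"
  have "closed ?S"
    using continuous_on_closed_Collect_le[OF cont continuous_on_const closed_atLeastAtMost] .
  moreover have "bounded ?S"
    by (rule bounded_subset[of "{0..t}"]) auto
  ultimately have "compact ?S"
    by (simp add: compact_eq_bounded_closed)
  moreover have "0 \<in> ?S"
    using assms by auto
  ultimately obtain s where s: "s \<in> ?S" and max: "\<And>r. r \<in> ?S \<Longrightarrow> r \<le> s"
    using compact_attains_sup[of ?S] by blast
  have "s < t"
    using s assms by (cases "s = t") auto
  have after: "c < f r" if "s < r" "r \<le> t" for r
    using max[of r] that s by (auto simp: not_le[symmetric])
  have "f s = c"
  proof (rule ccontr)
    assume "f s \<noteq> c"
    then have "f s < c"
      using s by auto
    moreover have "continuous_on {s..t} f"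
      using cont s by (auto intro: continuous_on_subset)
    ultimately obtain r where "s \<le> r" "r \<le> t" "f r = c"
      using IVT'[of f s c t] \<open>s < t\<close> assms by auto
    then show False
      using after[of r] \<open>f s < c\<close> by (cases "r = s") auto
  qed
  with s \<open>s < t\<close> after show thesis
    by (intro that[of s]) auto
qed

locale feasible_schedule =
  fixes n :: nat and p :: "nat \<Rightarrow> real" and \<sigma> :: "nat \<Rightarrow> real \<Rightarrow> real"
  assumes sched: "schedule n p \<sigma>" and p_pos: "\<And>j. j < n \<Longrightarrow> 0 < p j"
begin

abbreviation w :: "nat \<Rightarrow> real \<Rightarrow> real" where
  "w \<equiv> work \<sigma>"

lemma integrable: "j < n \<Longrightarrow> 0 \<le> s \<Longrightarrow> \<sigma> j integrable_on {s..t}"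
  using sched integrable_subinterval_real[of "\<sigma> j" 0 t s t]
  by (cases "0 \<le> t") (auto simp: schedule_def)

lemma rate_nonneg: "j < n \<Longrightarrow> 0 \<le> t \<Longrightarrow> 0 \<le> \<sigma> j t"
  using sched by (auto simp: schedule_def)

lemma rate_sum_le: "0 \<le> t \<Longrightarrow> (\<Sum>j<n. \<sigma> j t) \<le> 1"
  using sched by (auto simp: schedule_def)

lemma rate_eq_0_if_finished: "j < n \<Longrightarrow> 0 \<le> t \<Longrightarrow> p j \<le> w j t \<Longrightarrow> \<sigma> j t = 0"
  using sched by (force simp: schedule_def unfinished_def)

lemma other_rate_eq_0:
  assumes "\<sigma> i t = 1" "i < n" "j < n" "i \<noteq> j" "0 \<le> t"
  shows "\<sigma> j t = 0"
proof -
  have "\<sigma> i t + \<sigma> j t = (\<Sum>l\<in>{i,j}. \<sigma> l t)"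
    using assms by simp
  also have "\<dots> \<le> (\<Sum>l<n. \<sigma> l t)"
    by (rule sum_mono2) (use assms rate_nonneg in auto)
  also have "\<dots> \<le> 1"
    using rate_sum_le assms by simp
  finally show ?thesis
    using assms rate_nonneg[of j t] by simp
qed

lemma work_diff: "j < n \<Longrightarrow> 0 \<le> s \<Longrightarrow> s \<le> t \<Longrightarrow> w j t - w j s = integral {s..t} (\<sigma> j)"
  unfolding work_def using Henstock_Kurzweil_Integration.integral_combine[of 0 s t "\<sigma> j"] integrable[of j 0 t] by simp

lemma work_0 [simp]: "w j 0 = 0"
  by (simp add: work_def)

lemma work_mono: "j < n \<Longrightarrow> 0 \<le> s \<Longrightarrow> s \<le> t \<Longrightarrow> w j s \<le> w j t"
  using work_diff[of j s t] integral_nonneg[of "\<sigma> j" "{s..t}"] integrable rate_nonneg by auto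

lemma work_nonneg: "j < n \<Longrightarrow> 0 \<le> t \<Longrightarrow> 0 \<le> w j t"
  using work_mono[of j 0 t] by simp

lemma continuous_work: "j < n \<Longrightarrow> continuous_on {0..t} (w j)"
  unfolding work_def using indefinite_integral_continuous_1[of "\<sigma> j" 0 t] integrable by simp

text \<open>The endpoints form a null set. Leaving them out matters later: nothing is known about
  the rate at the crossing time \<open>s\<close> itself.\<close>

lemma work_const_if_rate_0:
  assumes "j < n" "0 \<le> s" "s \<le> t" and "\<And>r. s < r \<Longrightarrow> r < t \<Longrightarrow> \<sigma> j r = 0"
  shows "w j t = w j s"
proof -
  have "integral {s..t} (\<sigma> j) = integral {s..t} (\<lambda>_. 0)"
    by (rule integral_spike[of "{s,t}"]) (use assms in auto)
  then show ?thesis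
    using work_diff[of j s t] assms by simp
qed

text \<open>Beyond the last time at which the work equals \<open>p j\<close> the job counts as
  finished, so its rate vanishes and the work cannot grow.\<close>

lemma work_le:
  assumes "j < n" "0 \<le> t"
  shows "w j t \<le> p j"
proof (rule ccontr)
  assume "\<not> w j t \<le> p j"
  then have "p j < w j t" "w j 0 \<le> p j"
    using p_pos[of j] assms by auto
  then obtain s where s: "0 \<le> s" "s < t" "w j s = p j"
    using last_crossing[OF continuous_work] assms by metis
  have "w j t = w j s"
    by (rule work_const_if_rate_0)
      (use s assms rate_eq_0_if_finished work_mono[of j s] in force)+
  with s \<open>\<not> w j t \<le> p j\<close> show False
    by simp
qed

lemma sum_work:
  assumes "0 \<le> t"
  shows "(\<Sum>j<n. w j t) = integral {0..t} (\<lambda>s. \<Sum>j<n. \<sigma> j s)"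
  unfolding work_def by (subst integral_sum) (use assms integrable in auto)

lemma sum_work_le:
  assumes "0 \<le> t"
  shows "(\<Sum>j<n. w j t) \<le> t"
proof -
  have "integral {0..t} (\<lambda>s. \<Sum>j<n. \<sigma> j s) \<le> integral {0..t} (\<lambda>_. 1)"
    by (rule integral_le) (use integrable rate_sum_le assms in \<open>auto intro!: integrable_sum\<close>)
  then show ?thesis
    using sum_work assms by simp
qed

end

section \<open>Completion times and the lower bound on the optimum\<close>

locale complete_schedule = feasible_schedule +
  assumes compl: "completes_all n p \<sigma>"
begin

abbreviation C :: "nat \<Rightarrow> real" where
  "C \<equiv> completion_time p \<sigma>"

lemma completion:
  assumes "j < n"
  shows completion_nonneg: "0 \<le> C j"
    and work_completion: "w j (C j) = p j"
    and unfinished_before: "0 \<le> t \<Longrightarrow> t < C j \<Longrightarrow> w j t < p j"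
proof -
  obtain T where T: "0 \<le> T" "p j \<le> w j T"
    using compl assms by (auto simp: completes_all_def)
  let ?S = "{t. 0 \<le> t \<and> p j \<le> w j t}"
  let ?S' = "{t \<in> {0..T}. p j \<le> w j t}"
  have "closed ?S'"
    using continuous_on_closed_Collect_le[OF continuous_on_const continuous_work closed_atLeastAtMost]
      assms by simp
  moreover have "bounded ?S'"
    by (rule bounded_subset[of "{0..T}"]) auto
  ultimately have "compact ?S'"
    by (simp add: compact_eq_bounded_closed)
  then obtain s where s: "s \<in> ?S'" and "\<And>t. t \<in> ?S' \<Longrightarrow> s \<le> t"
    using compact_attains_inf[of ?S'] T by auto
  then have min: "s \<le> t" if "t \<in> ?S" for t
    using that by (cases "t \<le> T") auto
  have "C j = s"
    unfolding completion_time_def by (rule cInf_eq_minimum) (use s min in auto)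
  then show "0 \<le> C j" "w j (C j) = p j"
    using s work_le[of j s] assms by auto
  show "w j t < p j" if "0 \<le> t" "t < C j"
    using min[of t] that \<open>C j = s\<close> by (auto simp: not_le[symmetric])
qed

text \<open>At time \<open>C j\<close> at most \<open>C j\<close> units of work have been done, so
  the total cost is at least the sum of \<open>w i (C j)\<close> over ordered pairs. Of two jobs,
  the first to complete contributes its whole size to the other. The diagonal yields
  \<open>2 * p j\<close>, hence the extra sum.\<close>

lemma total_completion_time_lower_bound:
  "(\<Sum>i<n. \<Sum>j<n. min (p i) (p j)) + (\<Sum>j<n. p j) \<le> 2 * total_completion_time n p \<sigma>"
proof -
  have pair: "min (p i) (p j) + (if i = j then p j else 0) \<le> w i (C j) + w j (C i)"
    if "i < n" "j < n" for i j
  proof -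
    have first: "p i \<le> w i (C j)" if "C i \<le> C j" "i < n" "j < n" for i j
      using work_mono[of i "C i" "C j"] work_completion[of i] completion_nonneg[of i] that by simp
    have "0 \<le> w i (C j)" "0 \<le> w j (C i)"
      using that work_nonneg completion_nonneg by auto
    then show ?thesis
      using first[of i j] first[of j i] work_completion[of i] that
      by (cases "i = j"; cases "C i \<le> C j") (auto simp: min_def)
  qed
  have "(\<Sum>i<n. \<Sum>j<n. min (p i) (p j)) + (\<Sum>j<n. p j)
      = (\<Sum>i<n. \<Sum>j<n. min (p i) (p j) + (if i = j then p j else 0))"
    by (simp add: sum.distrib)
  also have "\<dots> \<le> (\<Sum>i<n. \<Sum>j<n. w i (C j) + w j (C i))"
    by (intro sum_mono pair) auto
  also have "\<dots> = 2 * (\<Sum>j<n. \<Sum>i<n. w i (C j))"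
    by (simp add: sum.distrib) (subst sum.swap, simp)
  also have "\<dots> \<le> 2 * total_completion_time n p \<sigma>"
    unfolding total_completion_time_def
    by (intro mult_left_mono sum_mono sum_work_le completion_nonneg) auto
  finally show ?thesis .
qed

end

text \<open>The schedule \<open>\<sigma>\<close> witnesses that the set under \<open>Inf\<close> is
  nonempty; the infimum of the empty set of reals would say nothing.\<close>

lemma opt_lower_bound:
  assumes "\<And>j. j < n \<Longrightarrow> 0 < p j" and "schedule n p \<sigma>" "completes_all n p \<sigma>"
  shows "(\<Sum>i<n. \<Sum>j<n. min (p i) (p j)) + (\<Sum>j<n. p j) \<le> 2 * opt n p"
proof -
  let ?L = "(\<Sum>i<n. \<Sum>j<n. min (p i) (p j)) + (\<Sum>j<n. p j)"
  have "?L / 2 \<le> opt n p"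
    unfolding opt_def
  proof (rule cInf_greatest)
    show "{total_completion_time n p \<sigma> |\<sigma>. schedule n p \<sigma> \<and> completes_all n p \<sigma>} \<noteq> {}"
      using assms by auto
    fix x assume "x \<in> {total_completion_time n p \<sigma> |\<sigma>. schedule n p \<sigma> \<and> completes_all n p \<sigma>}"
    then obtain \<sigma>' where x: "x = total_completion_time n p \<sigma>'"
      and \<sigma>': "schedule n p \<sigma>'" "completes_all n p \<sigma>'"
      by auto
    then interpret complete_schedule n p \<sigma>'
      by unfold_locales (use assms in auto)
    show "?L / 2 \<le> x"
      using total_completion_time_lower_bound x by simp
  qed
  then show ?thesis
    by simp
qed

section \<open>Runs of Repeated Explore-Then-Commit\<close>

text \<open>The bars influence a run only through the work \<open>q j\<close> at which each job
  reaches the threshold. Abstracting to these numbers makes the analysis deterministic.\<close>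

locale threshold_run = feasible_schedule +
  fixes q :: "nat \<Rightarrow> real"
  assumes q_nonneg: "\<And>j. j < n \<Longrightarrow> 0 \<le> q j" and q_le: "\<And>j. j < n \<Longrightarrow> q j \<le> p j"
    and run: "\<And>t. 0 \<le> t \<Longrightarrow>
      if {j \<in> unfinished n p \<sigma> t. q j \<le> work \<sigma> j t} = {}
      then \<forall>j\<in>unfinished n p \<sigma> t. \<sigma> j t = 1 / real (card (unfinished n p \<sigma> t))
      else \<exists>j\<in>{j \<in> unfinished n p \<sigma> t. q j \<le> work \<sigma> j t}.
             \<forall>s\<ge>t. j \<in> unfinished n p \<sigma> s \<longrightarrow> \<sigma> j s = 1"
begin

lemma run_cases:
  assumes "0 \<le> t"
  obtains (share) "\<And>j. j < n \<Longrightarrow> w j t < p j \<Longrightarrow>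
      w j t < q j \<and> \<sigma> j t = 1 / real (card (unfinished n p \<sigma> t))"
  | (commit) c where "c < n" "w c t < p c" "q c \<le> w c t"
      "\<And>s. t \<le> s \<Longrightarrow> w c s < p c \<Longrightarrow> \<sigma> c s = 1"
proof (cases "{j \<in> unfinished n p \<sigma> t. q j \<le> w j t} = {}")
  case True
  then have "\<forall>j\<in>unfinished n p \<sigma> t. \<sigma> j t = 1 / real (card (unfinished n p \<sigma> t))"
    using run[OF assms] unfolding if_P[OF True] by blast
  then show thesis
    using True by (intro share) (auto simp: unfinished_def)
next
  case False
  then obtain c where "c \<in> unfinished n p \<sigma> t" "q c \<le> w c t"
    "\<And>s. t \<le> s \<Longrightarrow> c \<in> unfinished n p \<sigma> s \<Longrightarrow> \<sigma> c s = 1"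
    using run[OF assms] unfolding if_not_P[OF False] by blast
  then show thesis
    by (intro commit[of c]) (auto simp: unfinished_def)
qed

lemma rate_sum_eq_1:
  assumes "0 \<le> t" "j < n" "w j t < p j"
  shows "(\<Sum>j<n. \<sigma> j t) = 1"
  using \<open>0 \<le> t\<close>
proof (cases rule: run_cases)
  case share
  let ?U = "unfinished n p \<sigma> t"
  have U: "?U \<subseteq> {..<n}" "finite ?U" "?U \<noteq> {}"
    using assms by (auto simp: unfinished_def intro: finite_subset[of _ "{..<n}"])
  have "(\<Sum>j<n. \<sigma> j t) = (\<Sum>j\<in>?U. \<sigma> j t)"
    using U rate_eq_0_if_finished assms
    by (intro sum.mono_neutral_right) (auto simp: unfinished_def)
  also have "\<dots> = (\<Sum>j\<in>?U. 1 / real (card ?U))"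
    by (intro sum.cong) (use share in \<open>auto simp: unfinished_def\<close>)
  also have "\<dots> = 1"
    using U by (simp add: card_eq_0_iff)
  finally show ?thesis .
next
  case (commit c)
  then have "1 = \<sigma> c t"
    by simp
  also have "\<dots> \<le> (\<Sum>j<n. \<sigma> j t)"
    by (rule member_le_sum) (use commit rate_nonneg assms in auto)
  finally show ?thesis
    using rate_sum_le[of t] assms by simp
qed

text \<open>The machine is busy as long as some job is unfinished. Requiring this only before
  \<open>t\<close> allows \<open>t\<close> to be the completion time of \<open>j\<close>.\<close>

lemma sum_work_eq:
  assumes "0 \<le> t" "j < n" and "\<And>r. 0 \<le> r \<Longrightarrow> r < t \<Longrightarrow> w j r < p j"
  shows "(\<Sum>j<n. w j t) = t"
proof -
  have "integral {0..t} (\<lambda>s. \<Sum>j<n. \<sigma> j s) = integral {0..t} (\<lambda>_. 1)"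
    by (rule integral_spike[of "{t}"]) (use rate_sum_eq_1[of _ j] assms in auto)
  then show ?thesis
    using sum_work assms by simp
qed

text \<open>A job unfinished at time \<open>?T\<close> would have kept the machine busy throughout,
  so \<open>?T\<close> units of work were done; but one unfinished job makes the total strictly
  less.\<close>

lemma completes_all: "completes_all n p \<sigma>"
  unfolding completes_all_def
proof (intro allI impI)
  fix j assume "j < n"
  let ?T = "\<Sum>i<n. p i"
  have "0 \<le> ?T"
    using p_pos by (auto intro!: sum_nonneg simp: less_imp_le)
  moreover have "p j \<le> w j ?T"
  proof (rule ccontr)
    assume "\<not> p j \<le> w j ?T"
    then have less: "w j ?T < p j"
      by simp
    then have "?T = (\<Sum>i<n. w i ?T)"
      using sum_work_eq[of ?T j] work_mono[of j _ ?T] \<open>j < n\<close> \<open>0 \<le> ?T\<close> by force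
    also have "\<dots> < ?T"
      by (rule sum_strict_mono_ex1) (use work_le \<open>0 \<le> ?T\<close> \<open>j < n\<close> less in auto)
    finally show False
      by simp
  qed
  ultimately show "\<exists>t\<ge>0. p j \<le> w j t"
    by blast
qed

sublocale complete_schedule
  by unfold_locales (rule completes_all)

lemma completion_time_eq: "j < n \<Longrightarrow> C j = (\<Sum>i<n. w i (C j))"
  using sum_work_eq[of "C j" j] completion_nonneg unfinished_before by simp

text \<open>A job gets ahead of another one only by being committed, hence not before its threshold.\<close>

lemma threshold_le_if_ahead:
  assumes "i < n" "j < n" "0 \<le> t" "t \<le> C i" "t \<le> C j" "w i t < w j t"
  shows "q j \<le> w i t"
proof (rule ccontr)
  assume "\<not> q j \<le> w i t"
  let ?D = "\<lambda>r. w j r - w i r"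
  have "continuous_on {0..t} ?D"
    using assms continuous_work by (auto intro!: continuous_intros)
  then obtain s where s: "0 \<le> s" "s < t" "?D s = 0" and ahead: "\<And>r. s < r \<Longrightarrow> r \<le> t \<Longrightarrow> 0 < ?D r"
    using last_crossing[of t ?D 0] assms by auto
  have "w j s < q j"
    using s work_mono[of i s t] assms \<open>\<not> q j \<le> w i t\<close> by auto
  \<comment> \<open>On \<open>{s..r}\<close> both jobs are unfinished and \<open>j\<close> is below
    its threshold, so \<open>j\<close> is never the committed job and gains nothing on
    \<open>i\<close>. Yet it must be ahead at \<open>r > s\<close>.\<close>
  obtain r where r: "s < r" "r < t" "w j r < q j"
  proof (cases "w j t < q j")
    case True
    then show thesis
      using that[of "(s + t) / 2"] s work_mono[of j "(s + t) / 2" t] assms by auto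
  next
    case False
    have "continuous_on {s..t} (w j)"
      using continuous_work[of j t] s assms by (auto intro: continuous_on_subset)
    then obtain r where r: "s \<le> r" "r \<le> t" "w j r = (w j s + q j) / 2"
      using IVT'[of "w j" s "(w j s + q j) / 2" t] s False \<open>w j s < q j\<close> by auto
    then show thesis
      using that[of r] False \<open>w j s < q j\<close> by (cases "r = s"; cases "r = t") auto
  qed
  have "\<sigma> j x \<le> \<sigma> i x" if x: "x \<in> {s..r}" for x
  proof -
    have "0 \<le> x" and unfin: "w i x < p i" "w j x < p j"
      using x s r assms unfinished_before by auto
    from \<open>0 \<le> x\<close> show ?thesis
    proof (cases rule: run_cases)
      case share
      then show ?thesis
        using unfin assms by simp
    next
      case (commit c)
      have "w j x \<le> w j r"
        using work_mono x s assms by auto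
      then have "c \<noteq> j"
        using r commit by auto
      then have "\<sigma> j x = 0"
        using other_rate_eq_0[of c x j] commit assms \<open>0 \<le> x\<close> by simp
      then show ?thesis
        using rate_nonneg assms \<open>0 \<le> x\<close> by simp
    qed
  qed
  then have "integral {s..r} (\<sigma> j) \<le> integral {s..r} (\<sigma> i)"
    by (intro integral_le integrable) (use s assms in auto)
  then have "?D r \<le> ?D s"
    using work_diff[of j s r] work_diff[of i s r] s r assms by simp
  then show False
    using ahead[of r] s r by simp
qed

text \<open>Once past its threshold, a job can receive capacity only as the committed job, and a
  commitment lasts until completion.\<close>

lemma exclusive_after_threshold:
  assumes "i < n" "0 \<le> t" "t \<le> C i" "q i < w i t"
  obtains s where "0 \<le> s" "s < t" "w i s = q i"
    "\<And>j. j < n \<Longrightarrow> j \<noteq> i \<Longrightarrow> w j t = w j s"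
proof -
  obtain s where s: "0 \<le> s" "s < t" "w i s = q i" and past: "\<And>r. s < r \<Longrightarrow> r \<le> t \<Longrightarrow> q i < w i r"
    using last_crossing[OF continuous_work, of i t "q i"] assms q_nonneg[of i] by auto
  \<comment> \<open>The work exceeds \<open>q i\<close> right after \<open>s\<close>, so
    \<open>i\<close> runs at times arbitrarily close to \<open>s\<close>. It is committed at such a
    time, hence has rate 1 on all of the open interval from \<open>s\<close> to
    \<open>t\<close>.\<close>
  have running: "\<exists>x. s < x \<and> x < r \<and> \<sigma> i x \<noteq> 0" if "s < r" "r \<le> t" for r
  proof (rule ccontr)
    assume "\<not> ?thesis"
    then have "w i r = w i s"
      by (intro work_const_if_rate_0) (use s that assms in auto)
    then show False
      using past[of r] s that by simp
  qed
  have "\<sigma> i r = 1" if r: "s < r" "r < t" for r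
  proof -
    obtain x where x: "s < x" "x < r" "\<sigma> i x \<noteq> 0"
      using running r by fastforce
    have unfin: "w i x < p i" "w i r < p i"
      using x s r assms unfinished_before by auto
    have "0 \<le> x"
      using x s by simp
    then show ?thesis
    proof (cases rule: run_cases)
      case share
      then show ?thesis
        using past[of x] x r unfin assms by force
    next
      case (commit c)
      then have "c = i"
        using other_rate_eq_0[of c x i] x s assms by fastforce
      then show ?thesis
        using commit(4)[of r] unfin x by simp
    qed
  qed
  then have "w j t = w j s" if "j < n" "j \<noteq> i" for j
    by (intro work_const_if_rate_0) (use other_rate_eq_0[of i _ j] s that assms in auto)
  with s show thesis
    by (rule that)
qed

text \<open>If \<open>i\<close> had passed \<open>q i\<close> before \<open>C j\<close>, the work of
  \<open>j\<close> would be frozen from some earlier time on, and \<open>j\<close> could not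
  complete at \<open>C j\<close>. The other bounds compare who is ahead when \<open>j\<close>
  completes and when it reaches its threshold.\<close>

lemma work_at_earlier_completion:
  assumes "i < n" "j < n" "i \<noteq> j" "C j \<le> C i"
  shows "q j \<le> q i" and "w i (C j) \<le> min (q i) (q j)"
proof -
  have pos: "0 \<le> C j"
    using completion_nonneg assms by simp
  have le_qi: "w i (C j) \<le> q i"
  proof (rule ccontr)
    assume "\<not> ?thesis"
    then obtain s where s: "0 \<le> s" "s < C j" "w j (C j) = w j s"
      using exclusive_after_threshold[of i "C j"] assms pos by (metis not_le)
    then show False
      using unfinished_before[of j s] work_completion[of j] assms by simp
  qed
  show "q j \<le> q i"
  proof (cases "w i (C j) < p j")
    case True
    then show ?thesis
      using threshold_le_if_ahead[of i j "C j"] work_completion[of j] pos assms le_qi by simp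
  next
    case False
    then show ?thesis
      using q_le[of j] le_qi assms by simp
  qed
  \<comment> \<open>From \<open>s\<close> on \<open>j\<close> runs alone, so the work of
    \<open>i\<close> at \<open>C j\<close> can be read off at \<open>s\<close>. If
    \<open>q j = p j\<close> there is no exclusive phase and \<open>s\<close> is
    \<open>C j\<close>.\<close>
  obtain s where s: "0 \<le> s" "s \<le> C j" "w j s = q j" "w i s = w i (C j)"
  proof (cases "q j = p j")
    case True
    then show thesis
      using that[of "C j"] pos work_completion[of j] assms by simp
  next
    case False
    then have "q j < w j (C j)"
      using q_le[of j] work_completion[of j] assms by simp
    then show thesis
      using exclusive_after_threshold[of j "C j"] that pos assms by (metis less_imp_le order_refl)
  qed
  have "w i s \<le> q j"
  proof (rule ccontr)
    assume "\<not> w i s \<le> q j"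
    then have "q i \<le> q j"
      using threshold_le_if_ahead[of j i s] s assms by simp
    then show False
      using \<open>\<not> w i s \<le> q j\<close> le_qi s by simp
  qed
  then show "w i (C j) \<le> min (q i) (q j)"
    using le_qi s by simp
qed

lemma competitive:
  assumes "0 < lo" "lo \<le> hi" and \<beta>: "\<And>j. j < n \<Longrightarrow> min 1 lo * p j \<le> q j \<and> q j \<le> min 1 hi * p j"
    and c: "hi / lo + hi \<le> c"
  shows "total_completion_time n p \<sigma> \<le> c * opt n p"
proof -
  let ?R = "hi / lo + hi"
  \<comment> \<open>Capping both ends of the window at 1 cannot increase their ratio.\<close>
  have "min 1 hi \<le> hi / lo * min 1 lo"
    using assms(1,2) by (auto simp: min_def field_simps)
  have "1 \<le> hi / lo"
    using assms(1,2) by simp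
  have "0 < hi"
    using assms by simp
  have earlier: "w i (C j) + w j (C i) \<le> ?R * min (p i) (p j)"
    if ij: "i < n" "j < n" "i \<noteq> j" "C j \<le> C i" for i j
  proof -
    note early = work_at_earlier_completion[OF ij]
    \<comment> \<open>From \<open>q j \<le> q i\<close>: the job completing first cannot be larger
      than the other by more than the factor \<open>hi / lo\<close>. Its full size is thus charged
      to the minimum.\<close>
    have "min 1 lo * p j \<le> min 1 hi * p i"
      using \<beta>[of i] \<beta>[of j] early ij by linarith
    also have "\<dots> \<le> (hi / lo * min 1 lo) * p i"
      using \<open>min 1 hi \<le> _\<close> p_pos[of i] ij by (intro mult_right_mono) auto
    finally have "min 1 lo * p j \<le> min 1 lo * (hi / lo * p i)"
      by (simp add: mult_ac)
    then have "p j \<le> hi / lo * p i"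
      by (rule mult_left_le_imp_le) (use assms(1) in simp)
    moreover have "p j \<le> hi / lo * p j"
      using mult_right_mono[OF \<open>1 \<le> hi / lo\<close>, of "p j"] p_pos[of j] ij by simp
    moreover have "w j (C i) \<le> p j"
      using work_le completion_nonneg ij by simp
    ultimately have "w j (C i) \<le> hi / lo * min (p i) (p j)"
      by (auto simp: min_def)
    moreover have "q l \<le> hi * p l" if "l < n" for l
      using \<beta>[OF that] p_pos[OF that] mult_right_mono[of "min 1 hi" hi "p l"] by linarith
    then have "w i (C j) \<le> hi * min (p i) (p j)"
      using early(2) ij by (force simp: min_def split: if_splits)
    ultimately show ?thesis
      by (simp add: distrib_right)
  qed
  have pair: "w i (C j) + w j (C i) \<le> ?R * (min (p i) (p j) + (if i = j then p j else 0))"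
    if ij: "i < n" "j < n" for i j
  proof (cases "i = j")
    case True
    have "1 * (2 * p j) \<le> ?R * (2 * p j)"
      using \<open>1 \<le> hi / lo\<close> \<open>0 < hi\<close> p_pos[of j] ij by (intro mult_right_mono) auto
    then show ?thesis
      using True work_completion ij by simp
  next
    case False
    then show ?thesis
      using earlier[of i j] earlier[of j i] ij by (cases "C j \<le> C i") (auto simp: min.commute add.commute)
  qed
  have "2 * total_completion_time n p \<sigma> = 2 * (\<Sum>j<n. \<Sum>i<n. w i (C j))"
    unfolding total_completion_time_def using completion_time_eq by (intro arg_cong2[where f = "(*)"] sum.cong) auto
  also have "\<dots> = (\<Sum>i<n. \<Sum>j<n. w i (C j) + w j (C i))"
    by (simp add: sum.distrib) (subst sum.swap, simp)
  also have "\<dots> \<le> (\<Sum>i<n. \<Sum>j<n. ?R * (min (p i) (p j) + (if i = j then p j else 0)))"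
    by (intro sum_mono pair) auto
  also have "\<dots> = ?R * ((\<Sum>i<n. \<Sum>j<n. min (p i) (p j)) + (\<Sum>j<n. p j))"
    by (simp add: sum.distrib sum_distrib_left[symmetric])
  also have "\<dots> \<le> c * (2 * opt n p)"
    using opt_lower_bound[of n p \<sigma>] p_pos sched compl c \<open>1 \<le> hi / lo\<close> \<open>0 < hi\<close>
    by (intro mult_mono add_nonneg_nonneg sum_nonneg) (auto simp: less_imp_le)
  finally show ?thesis
    by simp
qed

end

section \<open>From displayed progress to work thresholds\<close>

text \<open>Displayed progress counts jumps up to \<open>y\<close>; since jumps are sorted, there
  are at least \<open>k\<close> of them exactly when the \<open>k\<close>-th one has been passed.
  The case \<open>h = 0\<close> of the sortedness assumption is trivial by truncated
  subtraction.\<close>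

lemma displayed_progress_ge_iff:
  assumes x: "\<And>h. h < g \<Longrightarrow> x (h - 1) \<le> x h" and k: "1 \<le> k" "k \<le> g"
  shows "real k / real (g + 1) \<le> displayed_progress g x y \<longleftrightarrow> bar_jump g x k \<le> y"
proof -
  have mono: "bar_jump g x h \<le> bar_jump g x h'" if "1 \<le> h" "h \<le> h'" for h h'
    using that(2)
  proof (induction h' rule: dec_induct)
    case (step m)
    then have "bar_jump g x m \<le> bar_jump g x (Suc m)"
      using x[of m] by (auto simp: bar_jump_def min_def)
    with step show ?case
      by simp
  qed simp
  let ?J = "{h \<in> {1..g+1}. bar_jump g x h \<le> y}"
  have "(\<Sum>h=1..g+1. of_bool (bar_jump g x h \<le> y)) = real (card ?J)"
    by (subst sum_of_bool_eq) (auto intro: arg_cong[where f = card])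
  then have "real k / real (g + 1) \<le> displayed_progress g x y \<longleftrightarrow> k \<le> card ?J"
    unfolding displayed_progress_def by (simp add: divide_le_cancel)
  also have "\<dots> \<longleftrightarrow> bar_jump g x k \<le> y"
  proof
    assume "k \<le> card ?J"
    show "bar_jump g x k \<le> y"
    proof (rule ccontr)
      assume "\<not> ?thesis"
      then have "?J \<subseteq> {1..<k}"
        using mono[of k] k by (fastforce simp: not_le[symmetric])
      from card_mono[OF _ this] show False
        using \<open>k \<le> card ?J\<close> k by simp
    qed
  next
    assume "bar_jump g x k \<le> y"
    then have "{1..k} \<subseteq> ?J"
      using mono[of _ k] k by fastforce
    from card_mono[OF _ this] show "k \<le> card ?J"
      by simp
  qed
  finally show ?thesis .
qed

lemma repeated_etc_competitive:
  assumes p: "\<And>j. j < n \<Longrightarrow> 0 < p j" and k: "1 \<le> k" "k \<le> g"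
    and x: "\<And>j h. j < n \<Longrightarrow> h < g \<Longrightarrow> x j (h - 1) \<le> x j h"
    and lo: "0 < lo" "lo \<le> hi" "\<And>j. j < n \<Longrightarrow> lo \<le> x j (k - 1) \<and> x j (k - 1) \<le> hi"
    and c: "hi / lo + hi \<le> c"
    and etc: "repeated_etc n p g k x \<sigma>"
  shows "total_completion_time n p \<sigma> \<le> c * opt n p"
proof -
  \<comment> \<open>Points are indexed from 0, so the \<open>k\<close>-th one is
    \<open>x j (k - 1)\<close>; \<open>k \<le> g\<close> ensures that jump \<open>k\<close> is not
    the final one fixed at 1.\<close>
  let ?q = "\<lambda>j. min 1 (x j (k - 1)) * p j"
  have triggered: "triggered n p g k x \<sigma> t = {j \<in> unfinished n p \<sigma> t. ?q j \<le> work \<sigma> j t}" for t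
    using displayed_progress_ge_iff[of g "x _" k] x k p
    by (auto simp: triggered_def unfinished_def bar_jump_def pos_le_divide_eq)
  interpret threshold_run n p \<sigma> ?q
  proof unfold_locales
    fix j assume "j < n"
    then show "0 \<le> ?q j" "?q j \<le> p j"
      using lo(1) lo(3)[of j] p[of j] by (auto simp: mult_le_cancel_right1)
  next
    fix t :: real assume "0 \<le> t"
    then show "if {j \<in> unfinished n p \<sigma> t. ?q j \<le> work \<sigma> j t} = {}
      then \<forall>j\<in>unfinished n p \<sigma> t. \<sigma> j t = 1 / real (card (unfinished n p \<sigma> t))
      else \<exists>j\<in>{j \<in> unfinished n p \<sigma> t. ?q j \<le> work \<sigma> j t}.
             \<forall>s\<ge>t. j \<in> unfinished n p \<sigma> s \<longrightarrow> \<sigma> j s = 1"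
      using etc unfolding repeated_etc_def triggered by blast
  qed (use etc p in \<open>auto simp: repeated_etc_def\<close>)
  show ?thesis
    by (rule competitive) (use lo p c in \<open>fastforce intro!: mult_right_mono simp: less_imp_le\<close>)+
qed

section \<open>Concentration of the threshold points\<close>

text \<open>
  Positive \<open>v\<close> gives the upper tail, negative \<open>v\<close> the lower one. Tilting by \<open>exp (v i)\<close> turns the
  Poisson weights, up to a constant factor, into those for the rate multiplied by \<open>exp v\<close>.
\<close>

lemma poisson_pmf_tail:
  fixes rate v a :: real
  assumes "0 < rate"
  shows "measure_pmf.prob (poisson_pmf rate) {i. 0 \<le> v * (real i - a)} \<le> exp (rate * (exp v - 1) - v * a)"
proof -
  let ?c = "exp (rate * (exp v - 1) - v * a)" and ?S = "{i. 0 \<le> v * (real i - a)}"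
  have pos: "0 < rate * exp v"
    using assms by simp
  have tilt: "pmf (poisson_pmf rate) i \<le> ?c * pmf (poisson_pmf (rate * exp v)) i" if "i \<in> ?S" for i
  proof -
    \<comment> \<open>On \<open>?S\<close> the tilting factor is at least 1.\<close>
    have "pmf (poisson_pmf rate) i * 1 \<le> pmf (poisson_pmf rate) i * exp (v * (real i - a))"
      using that by (intro mult_left_mono) auto
    also have "exp (v * (real i - a)) = exp v ^ i * exp (- (v * a))"
      by (simp add: algebra_simps exp_diff exp_minus exp_of_nat_mult[symmetric] divide_inverse)
    also have "pmf (poisson_pmf rate) i * (exp v ^ i * exp (- (v * a)))
        = ?c * pmf (poisson_pmf (rate * exp v)) i"
      using assms pos
      by (simp add: power_mult_distrib exp_diff exp_minus exp_add right_diff_distrib field_simps)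
    finally show ?thesis
      by simp
  qed
  have "emeasure (measure_pmf (poisson_pmf rate)) ?S
      = (\<integral>\<^sup>+i. ennreal (pmf (poisson_pmf rate) i) * indicator ?S i \<partial>count_space UNIV)"
    by (simp flip: nn_integral_measure_pmf)
  also have "\<dots> \<le> (\<integral>\<^sup>+i. ennreal ?c * ennreal (pmf (poisson_pmf (rate * exp v)) i) \<partial>count_space UNIV)"
    by (intro nn_integral_mono)
      (use tilt in \<open>auto simp: indicator_def ennreal_mult[symmetric] intro!: ennreal_leI\<close>)
  also have "\<dots> = ennreal ?c"
    by (subst nn_integral_cmult) (auto simp: nn_integral_pmf_eq_1)
  finally show ?thesis
    by (simp add: measure_pmf.emeasure_eq_measure)
qed

text \<open>The right-hand side is the Chernoff exponent per unit of \<open>k\<close>; the left-hand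
  side is a common bound for both tails.\<close>

lemma exp_rate_lower_bound:
  fixes v :: real
  shows "v\<^sup>2 / (2 + \<bar>v\<bar>) \<le> exp (- v) - 1 + v"
proof (cases "0 \<le> v")
  case True
  \<comment> \<open>This is the difference of the two sides multiplied by \<open>2 + x\<close>; it
    vanishes at 0.\<close>
  let ?f = "\<lambda>x::real. exp (- x) * (2 + x) - (2 - x)"
  have "?f 0 \<le> ?f v"
  proof (rule DERIV_nonneg_imp_nondecreasing[OF True])
    fix x :: real assume "0 \<le> x" "x \<le> v"
    have "1 + x \<le> exp x"
      by simp
    then have "exp (- x) * (1 + x) \<le> exp (- x) * exp x"
      by (intro mult_left_mono) auto
    then have "0 \<le> 1 - exp (- x) * (1 + x)"
      by (simp flip: exp_add)
    moreover have "(?f has_real_derivative 1 - exp (- x) * (1 + x)) (at x)"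
      by (auto intro!: derivative_eq_intros simp: algebra_simps)
    ultimately show "\<exists>y. (?f has_real_derivative y) (at x) \<and> 0 \<le> y"
      by blast
  qed
  then show ?thesis
    using True by (simp add: field_simps power2_eq_square)
next
  case False
  then have "0 \<le> - v"
    by simp
  then have "1 + (- v) + (- v)\<^sup>2 / 2 \<le> exp (- v)"
    by (rule exp_lower_Taylor_quadratic)
  moreover have "v\<^sup>2 / (2 + \<bar>v\<bar>) \<le> v\<^sup>2 / 2"
    by (intro divide_left_mono) auto
  ultimately show ?thesis
    by (simp only: power2_minus)
qed

text \<open>Tilting by \<open>v\<close> turns the rate into exactly \<open>k\<close>, so that the
  cutoff becomes the mean.\<close>

lemma poisson_pmf_tail_scaled:
  fixes u v :: real
  assumes "1 \<le> k" "\<bar>v\<bar> = u"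
  shows "measure_pmf.prob (poisson_pmf (real k * exp (- v))) {i. 0 \<le> v * (real i - real k)}
    \<le> exp (- (real k * (u\<^sup>2 / (2 + u))))"
proof -
  have "real k * (u\<^sup>2 / (2 + u)) \<le> real k * (exp (- v) - 1 + v)"
    using exp_rate_lower_bound[of v] assms(2) by (intro mult_left_mono) auto
  moreover have "real k * exp (- v) * (exp v - 1) - v * real k = - (real k * (exp (- v) - 1 + v))"
    by (simp add: algebra_simps flip: exp_add)
  ultimately show ?thesis
    using poisson_pmf_tail[of "real k * exp (- v)" v "real k"] assms(1)
    by (auto intro: order_trans)
qed

text \<open>This turns the position of the \<open>k\<close>-th point into a statement about counts.
  Divergence makes the index set finite; otherwise \<open>card\<close> would be 0 and the first
  bound would fail.\<close>

lemma point_count_bounds: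
  assumes "incseq x" "filterlim x at_top sequentially" "1 \<le> k"
  shows "x (k - 1) < y \<Longrightarrow> 0 \<le> x 0 \<Longrightarrow> k \<le> point_count x {0..y}"
    and "y < x (k - 1) \<Longrightarrow> point_count x {0..y} \<le> k"
proof -
  have "\<forall>\<^sub>F i in sequentially. y < x i"
    using assms(2) by (simp add: filterlim_at_top_dense)
  then obtain N where N: "\<And>i. N \<le> i \<Longrightarrow> y < x i"
    by (auto simp: eventually_sequentially)
  have fin: "finite {i. x i \<in> {0..y}}"
  proof (rule finite_subset)
    show "{i. x i \<in> {0..y}} \<subseteq> {..<N}"
    proof
      fix i assume "i \<in> {i. x i \<in> {0..y}}"
      then show "i \<in> {..<N}"
        using N[of i] by (cases "N \<le> i") auto
    qed
  qed simp
  show "k \<le> point_count x {0..y}" if "x (k - 1) < y" "0 \<le> x 0"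
  proof -
    have "{..<k} \<subseteq> {i. x i \<in> {0..y}}"
    proof
      fix i assume "i \<in> {..<k}"
      then have "x 0 \<le> x i" "x i \<le> x (k - 1)"
        using incseqD[OF assms(1), of 0 i] incseqD[OF assms(1), of i "k - 1"] by auto
      with that show "i \<in> {i. x i \<in> {0..y}}"
        by auto
    qed
    from card_mono[OF fin this] show ?thesis
      by (simp add: point_count_def)
  qed
  show "point_count x {0..y} \<le> k" if "y < x (k - 1)"
  proof -
    have "{i. x i \<in> {0..y}} \<subseteq> {..<k}"
    proof
      fix i assume "i \<in> {i. x i \<in> {0..y}}"
      then have "x i < x (k - 1)"
        using that by auto
      then show "i \<in> {..<k}"
        using incseqD[OF assms(1), of "k - 1" i] by (cases "k - 1 \<le> i") auto
    qed
    from card_mono[OF _ this] show ?thesis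
      by (simp add: point_count_def)
  qed
qed

text \<open>The sign of \<open>v\<close> selects the tail: a \<open>k\<close>-th point that is too
  early for \<open>v \<ge> 0\<close>, too late for \<open>v \<le> 0\<close>. The expected count up
  to \<open>y\<close> is \<open>k * exp (- v)\<close>.\<close>

lemma poisson_process_tail:
  fixes g k :: nat and u v :: real
  assumes "prob_space M" and proc: "poisson_process M (real g) \<tau>" and "1 \<le> k" "1 \<le> g"
    and v: "\<bar>v\<bar> = u"
  defines "y \<equiv> exp (- v) * real k / real g"
  assumes S: "S \<in> sets M"
    and beyond: "\<And>\<omega>. \<omega> \<in> S \<Longrightarrow> 0 \<le> v \<and> \<tau> \<omega> (k - 1) < y \<or> v \<le> 0 \<and> y < \<tau> \<omega> (k - 1)"
  shows "measure M S \<le> exp (- (real k * (u\<^sup>2 / (2 + u))))"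
proof -
  interpret prob_space M by fact
  let ?A = "{0..y}" and ?B = "{i. 0 \<le> v * (real i - real k)}"
  let ?N = "\<lambda>\<omega>. point_count (\<tau> \<omega>) ?A"
  have "0 < y"
    using assms by (auto simp: y_def)
  then have law: "distr M (count_space UNIV) ?N = measure_pmf (poisson_pmf (real k * exp (- v)))"
    using proc \<open>1 \<le> g\<close> unfolding poisson_process_def y_def
    by (auto simp: bounded_closed_interval mult.commute)
  \<comment> \<open>Measurability of counts is extracted from the independence clause, applied to a
    family of one set.\<close>
  have meas: "?N \<in> M \<rightarrow>\<^sub>M count_space UNIV"
  proof -
    have "indep_vars (\<lambda>_. count_space UNIV) (\<lambda>i \<omega>. point_count (\<tau> \<omega>) ?A) {..<1::nat}"
      using proc unfolding poisson_process_def
      by (elim conjE allE[of _ "1::nat"] allE[of _ "\<lambda>_. ?A"])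
        (auto simp: disjoint_family_on_def bounded_closed_interval)
    then show ?thesis
      by (auto simp: indep_vars_def)
  qed
  have "AE \<omega> in M. \<omega> \<in> S \<longrightarrow> \<omega> \<in> ?N -` ?B \<inter> space M"
  proof -
    have "AE \<omega> in M. (\<forall>i. 0 \<le> \<tau> \<omega> i) \<and> incseq (\<tau> \<omega>) \<and> filterlim (\<tau> \<omega>) at_top sequentially"
      using proc by (auto simp: poisson_process_def)
    with AE_space show ?thesis
    proof eventually_elim
      case (elim \<omega>)
      then show ?case
        using beyond[of \<omega>] point_count_bounds[of "\<tau> \<omega>" k y] \<open>1 \<le> k\<close>
        by (auto simp: zero_le_mult_iff split: if_splits)
    qed
  qed
  then have "measure M S \<le> measure M (?N -` ?B \<inter> space M)"
    by (intro finite_measure_mono_AE) (use meas in measurable)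
  also have "\<dots> = measure (distr M (count_space UNIV) ?N) ?B"
    by (rule measure_distr[symmetric, OF meas]) simp
  also have "\<dots> \<le> exp (- (real k * (u\<^sup>2 / (2 + u))))"
    unfolding law by (rule poisson_pmf_tail_scaled) fact+
  finally show ?thesis .
qed

section \<open>Competitive ratio with high probability\<close>

text \<open>A union bound over the two tails of each job puts all \<open>k\<close>-th points into
  the window, where \<open>hi / lo = exp (2 * u)\<close>.\<close>

lemma etc_competitive_with_prob_at_least:
  fixes u c Q :: real
  assumes k: "1 \<le> k" "k \<le> g" and p: "\<And>j. j < n \<Longrightarrow> 0 < p j" and bars: "poisson_bars M n g T"
    and "0 \<le> u" and c: "exp (2 * u) + exp u * (real k / real g) \<le> c"
    and Q: "Q \<le> 1 - 2 * real n * exp (- (real k * (u\<^sup>2 / (2 + u))))"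
  shows "with_prob_at_least M Q (etc_competitive n p g k T c)"
proof -
  interpret prob_space M
    using bars by (simp add: poisson_bars_def)
  have proc: "poisson_process M (real g) (T j)" if "j < n" for j
    using bars that by (simp add: poisson_bars_def)
  then have [measurable]: "(\<lambda>\<omega>. T j \<omega> i) \<in> borel_measurable M" if "j < n" for i j
    using that by (auto simp: poisson_process_def)
  define lo hi where "lo = exp (- u) * real k / real g" and "hi = exp u * real k / real g"
  have "0 < lo" "lo \<le> hi" and ratio: "hi / lo + hi \<le> c"
    using k \<open>0 \<le> u\<close> c
    by (auto simp: lo_def hi_def divide_right_mono mult_right_mono exp_minus field_simps mult_exp_exp)
  let ?\<delta> = "exp (- (real k * (u\<^sup>2 / (2 + u))))"
  let ?L = "\<lambda>j. {\<omega> \<in> space M. T j \<omega> (k - 1) < lo}" and ?H = "\<lambda>j. {\<omega> \<in> space M. hi < T j \<omega> (k - 1)}"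
  let ?B = "\<Union>j<n. ?L j \<union> ?H j"
  \<comment> \<open>Sortedness is part of the event so that runs can be analysed outcome by outcome;
    it holds almost surely and costs no probability.\<close>
  let ?E = "{\<omega> \<in> space M. \<forall>j<n. \<forall>h<g. T j \<omega> (h - 1) \<le> T j \<omega> h} - ?B"
  have sets: "?L j \<in> events" "?H j \<in> events" if "j < n" for j
    using that by measurable
  have B: "?B \<in> events"
    using sets by auto
  have sorted: "{\<omega> \<in> space M. \<forall>j<n. \<forall>h<g. T j \<omega> (h - 1) \<le> T j \<omega> h} \<in> events"
    by measurable
  have "prob (?L j \<union> ?H j) \<le> 2 * ?\<delta>" if "j < n" for j
  proof -
    have "prob (?L j) \<le> ?\<delta>"
      by (rule poisson_process_tail[OF prob_space_axioms proc, of j k u u])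
        (use that k \<open>0 \<le> u\<close> sets in \<open>auto simp: lo_def\<close>)
    moreover have "prob (?H j) \<le> ?\<delta>"
      by (rule poisson_process_tail[OF prob_space_axioms proc, of j k "- u" u])
        (use that k \<open>0 \<le> u\<close> sets in \<open>auto simp: hi_def\<close>)
    ultimately show ?thesis
      using measure_Un_le[of "?L j" M "?H j"] sets that by simp
  qed
  then have "(\<Sum>j<n. prob (?L j \<union> ?H j)) \<le> (\<Sum>j<n. 2 * ?\<delta>)"
    by (intro sum_mono) simp
  moreover have "prob ?B \<le> (\<Sum>j<n. prob (?L j \<union> ?H j))"
    by (rule finite_measure_subadditive_finite) (use sets in auto)
  ultimately have "prob ?B \<le> 2 * real n * ?\<delta>"
    by (simp add: mult_ac)
  moreover have "prob ?E = prob (space M - ?B)"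
  proof (rule finite_measure_eq_AE)
    have "AE \<omega> in M. \<forall>j\<in>{..<n}. incseq (T j \<omega>)"
      by (rule AE_finite_allI) (use proc in \<open>auto simp: poisson_process_def\<close>)
    then show "AE \<omega> in M. \<omega> \<in> ?E \<longleftrightarrow> \<omega> \<in> space M - ?B"
      by eventually_elim (auto simp: incseq_def)
  qed (use sorted B in auto)
  ultimately have "Q \<le> prob ?E"
    using Q prob_compl[OF B] by simp
  moreover have "etc_competitive n p g k T c \<omega>" if "\<omega> \<in> ?E" for \<omega>
    unfolding etc_competitive_def
  proof (intro allI impI)
    fix \<sigma> assume "repeated_etc n p g k (\<lambda>j. T j \<omega>) \<sigma>"
    then show "total_completion_time n p \<sigma> \<le> c * opt n p"
      by (intro repeated_etc_competitive[OF p k, where lo = lo and hi = hi and x = "\<lambda>j. T j \<omega>"])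
        (use that \<open>0 < lo\<close> \<open>lo \<le> hi\<close> ratio in \<open>force simp: not_less\<close>)+
  qed
  moreover have "?E \<in> events"
    using sorted B by auto
  ultimately show ?thesis
    unfolding with_prob_at_least_def by blast
qed

section \<open>Choice of the window for fixed accuracy\<close>

lemma exp_le_chord:
  fixes a s :: real
  assumes "0 \<le> s" "s \<le> 1"
  shows "exp (a * s) \<le> 1 + (exp a - 1) * s"
  using convex_onD[OF exp_convex assms, of 0 a] by (simp add: algebra_simps)

text \<open>With \<open>ln 2\<close> between 2/3 and 1, the right-hand side is at least 4/27 times
  the square of \<open>\<epsilon>\<close>, and 4/27 exceeds 1/7.\<close>

lemma tail_exponent_ln_2:
  fixes \<epsilon> :: real
  assumes "0 \<le> \<epsilon>" "\<epsilon> \<le> 1"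
  shows "\<epsilon>\<^sup>2 / 7 \<le> (\<epsilon> * ln 2)\<^sup>2 / (2 + \<epsilon> * ln 2)"
proof -
  have "2 / 3 \<le> ln (2::real)" "ln 2 \<le> (1::real)"
    using ln2_ge_two_thirds ln_le_minus_one[of "2::real"] by auto
  then have "(2 / 3)\<^sup>2 \<le> (ln 2 :: real)\<^sup>2"
    by (intro power_mono) auto
  have "\<epsilon> * ln 2 \<le> 1 * 1"
    using assms \<open>ln 2 \<le> 1\<close> by (intro mult_mono) auto
  have "\<epsilon>\<^sup>2 / 7 * (2 + \<epsilon> * ln 2) \<le> \<epsilon>\<^sup>2 / 7 * 3"
    using \<open>\<epsilon> * ln 2 \<le> 1 * 1\<close> by (intro mult_left_mono) auto
  also have "\<dots> \<le> \<epsilon>\<^sup>2 * (2 / 3)\<^sup>2"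
    by (simp add: power2_eq_square)
  also have "\<dots> \<le> \<epsilon>\<^sup>2 * (ln 2)\<^sup>2"
    by (intro mult_left_mono) (use \<open>(2 / 3)\<^sup>2 \<le> (ln 2 :: real)\<^sup>2\<close> in auto)
  finally show ?thesis
    using assms by (subst pos_le_divide_eq) (auto simp: power_mult_distrib add_pos_nonneg)
qed

text \<open>For \<open>u = \<epsilon> * ln 2\<close>, \<open>exp (2 * u)\<close> is 4 to the power
  \<open>\<epsilon>\<close>, whose chord over the unit interval is
  \<open>1 + 3 * \<epsilon>\<close>.\<close>

lemma etc_competitive_fixed_accuracy:
  fixes \<epsilon> :: real
  assumes k: "1 \<le> k" "k \<le> g" and p: "\<And>j. j < n \<Longrightarrow> 0 < p j" and bars: "poisson_bars M n g T"
    and \<epsilon>: "0 \<le> \<epsilon>" "\<epsilon> \<le> 1"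
  shows "with_prob_at_least M (1 - 2 * real n * exp (- (\<epsilon>\<^sup>2 * real k / 7)))
    (etc_competitive n p g k T (1 + 3 * \<epsilon> + 4 * (real k / real g)))"
proof (rule etc_competitive_with_prob_at_least[OF k p bars, where u = "\<epsilon> * ln 2"])
  have "exp (2 * (\<epsilon> * ln 2)) = exp (ln 4 * \<epsilon>)"
    using ln_realpow[of "2::real" 2] by (simp add: mult_ac)
  also have "\<dots> \<le> 1 + 3 * \<epsilon>"
    using exp_le_chord[OF \<epsilon>, of "ln 4"] by simp
  finally have "exp (2 * (\<epsilon> * ln 2)) \<le> 1 + 3 * \<epsilon>" .
  moreover have "exp (\<epsilon> * ln 2) \<le> 4"
    using exp_le_chord[OF \<epsilon>, of "ln 2"] \<epsilon> by (simp add: mult_ac)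
  then have "exp (\<epsilon> * ln 2) * (real k / real g) \<le> 4 * (real k / real g)"
    by (intro mult_right_mono) auto
  ultimately show "exp (2 * (\<epsilon> * ln 2)) + exp (\<epsilon> * ln 2) * (real k / real g)
      \<le> 1 + 3 * \<epsilon> + 4 * (real k / real g)"
    by simp
  have "\<epsilon>\<^sup>2 * real k / 7 \<le> real k * ((\<epsilon> * ln 2)\<^sup>2 / (2 + \<epsilon> * ln 2))"
    using mult_left_mono[OF tail_exponent_ln_2[OF \<epsilon>], of "real k"] by (simp add: mult_ac)
  then show "1 - 2 * real n * exp (- (\<epsilon>\<^sup>2 * real k / 7))
      \<le> 1 - 2 * real n * exp (- (real k * ((\<epsilon> * ln 2)\<^sup>2 / (2 + \<epsilon> * ln 2))))"
    by (intro diff_left_mono mult_left_mono) auto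
qed (use \<epsilon> in auto)

section \<open>The regime where the threshold is g to the power 2/3\<close>

lemma round_powr_two_thirds_bounds:
  assumes "1 \<le> g" and "int k = \<lfloor>real g powr (2 / 3)\<rfloor> \<or> int k = \<lceil>real g powr (2 / 3)\<rceil>"
  shows "1 \<le> k" "k \<le> g" "real g powr (2 / 3) / 2 \<le> real k" "real k \<le> 2 * real g powr (2 / 3)"
proof -
  let ?G = "real g powr (2 / 3)"
  have G: "1 \<le> ?G" "?G \<le> real g"
    using assms(1) ge_one_powr_ge_zero[of "real g" "2/3"] powr_mono[of "2/3" 1 "real g"] by auto
  then have "1 \<le> \<lfloor>?G\<rfloor>" "\<lceil>?G\<rceil> \<le> int g" "\<lfloor>?G\<rfloor> \<le> \<lceil>?G\<rceil>"
    by (auto simp: ceiling_le_iff le_floor_iff floor_le_ceiling)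
  then show k: "1 \<le> k" "k \<le> g"
    using assms(2) by linarith+
  have "real_of_int (int k) \<le> ?G + 1" "?G - 1 \<le> real_of_int (int k)"
    using assms(2) by linarith+
  with k G show "?G / 2 \<le> real k" "real k \<le> 2 * ?G"
    by linarith+
qed

text \<open>With \<open>u = K * s\<close> the tail exponent is at least
  \<open>K * \<alpha> * ln n / 4\<close>. \<open>K\<close> is chosen to make this
  \<open>(\<alpha> + 1) * ln n\<close>, where the extra 1 absorbs the factor \<open>n\<close> of the
  union bound.\<close>

lemma etc_competitive_high_prob:
  fixes \<alpha> :: real
  assumes "0 < \<alpha>"
  defines "K \<equiv> 4 * (\<alpha> + 1) / \<alpha>"
  assumes n: "1 \<le> n" and g: "1 \<le> g" and p: "\<And>j. j < n \<Longrightarrow> 0 < p j" and bars: "poisson_bars M n g T"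
    and regime: "sqrt (\<alpha> * ln (real n)) / real g powr (1 / 3) < 1"
    and k: "int k = \<lfloor>real g powr (2 / 3)\<rfloor> \<or> int k = \<lceil>real g powr (2 / 3)\<rceil>"
  shows "with_prob_at_least M (1 - 2 * real n powr (- \<alpha>))
    (etc_competitive n p g k T (1 + (exp (2 * K) - 1 + 2 * exp K / sqrt (\<alpha> * ln 2)) *
      (sqrt (\<alpha> * ln (real n)) / real g powr (1 / 3))))"
proof (cases "n = 1")
  case True
  then show ?thesis
    unfolding with_prob_at_least_def by (intro bexI[of _ "{}"]) auto
next
  case False
  define r where "r = real g powr (1 / 3)"
  define s where "s = sqrt (\<alpha> * ln (real n)) / r"
  have "0 < r"
    using g by (simp add: r_def)
  have r2: "real g powr (2 / 3) = r\<^sup>2" and r3: "real g = r ^ 3"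
    using g by (simp_all add: r_def powr_powr flip: powr_realpow)
  note kb = round_powr_two_thirds_bounds[OF g k, unfolded r2]
  have "4 \<le> K" and K: "\<alpha> * K = 4 * (\<alpha> + 1)"
    using \<open>0 < \<alpha>\<close> by (simp_all add: K_def field_simps)
  have ln: "0 < ln (2::real)" "ln 2 \<le> ln (real n)"
    using False n by auto
  then have ln_pos: "0 < ln (real n)"
    by linarith
  have "0 \<le> s" "s \<le> 1"
    using regime ln_pos \<open>0 < \<alpha>\<close> \<open>0 < r\<close> unfolding s_def r_def
    by (auto intro!: divide_nonneg_nonneg)
  have s2: "s\<^sup>2 * r\<^sup>2 = \<alpha> * ln (real n)"
    using ln_pos \<open>0 < \<alpha>\<close> \<open>0 < r\<close> by (simp add: s_def power_divide)
  have "with_prob_at_least M (1 - 2 * real n powr (- \<alpha>))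
    (etc_competitive n p g k T (1 + (exp (2 * K) - 1 + 2 * exp K / sqrt (\<alpha> * ln 2)) * s))"
  proof (rule etc_competitive_with_prob_at_least[OF kb(1,2) p bars, where u = "K * s"])
    show "0 \<le> K * s"
      using \<open>4 \<le> K\<close> \<open>0 \<le> s\<close> by simp
    have "exp (2 * (K * s)) \<le> 1 + (exp (2 * K) - 1) * s"
      using exp_le_chord[OF \<open>0 \<le> s\<close> \<open>s \<le> 1\<close>, of "2 * K"] by (simp add: mult_ac)
    moreover have "exp (K * s) * (real k / real g) \<le> exp K * (2 * s / sqrt (\<alpha> * ln 2))"
    proof (rule mult_mono)
      show "exp (K * s) \<le> exp K"
        using \<open>4 \<le> K\<close> \<open>s \<le> 1\<close> by (simp add: mult_le_cancel_left1)
      have "real k / real g \<le> 2 / r"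
        using kb(4) \<open>0 < r\<close> by (simp add: r3 field_simps power2_eq_square power3_eq_cube)
      \<comment> \<open>Here \<open>n \<ge> 2\<close> is essential: it keeps \<open>s * r\<close> at
        least \<open>sqrt (\<alpha> * ln 2)\<close>, so the term \<open>k / g\<close> is also of
        order \<open>s\<close>.\<close>
      also have "1 / r \<le> s / sqrt (\<alpha> * ln 2)"
        using ln \<open>0 < \<alpha>\<close> \<open>0 < r\<close> by (simp add: s_def field_simps)
      then have "2 / r \<le> 2 * s / sqrt (\<alpha> * ln 2)"
        by simp
      finally show "real k / real g \<le> 2 * s / sqrt (\<alpha> * ln 2)" .
    qed auto
    ultimately show "exp (2 * (K * s)) + exp (K * s) * (real k / real g)
        \<le> 1 + (exp (2 * K) - 1 + 2 * exp K / sqrt (\<alpha> * ln 2)) * s"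
      by (simp add: algebra_simps)
    have "K * s \<le> K * 1"
      using \<open>4 \<le> K\<close> \<open>s \<le> 1\<close> by (intro mult_left_mono) auto
    then have "2 + K * s \<le> 2 * K"
      using \<open>4 \<le> K\<close> by linarith
    then have "(\<alpha> + 1) * ln (real n) * (2 + K * s) \<le> (\<alpha> + 1) * ln (real n) * (2 * K)"
      using ln_pos \<open>0 < \<alpha>\<close> by (intro mult_left_mono mult_nonneg_nonneg) auto
    also have "\<dots> = (\<alpha> * K) * K * ln (real n) / 2"
      unfolding K by simp
    also have "\<dots> = K\<^sup>2 * (s\<^sup>2 * r\<^sup>2) / 2"
      unfolding s2 by (simp add: power2_eq_square)
    also have "\<dots> = r\<^sup>2 / 2 * (K * s)\<^sup>2"
      by (simp add: power_mult_distrib)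
    also have "\<dots> \<le> real k * (K * s)\<^sup>2"
      using kb(3) by (intro mult_right_mono) auto
    finally have "(\<alpha> + 1) * ln (real n) \<le> real k * ((K * s)\<^sup>2 / (2 + K * s))"
      using \<open>0 \<le> K * s\<close> by (simp add: pos_le_divide_eq add_pos_nonneg)
    then have "exp (- (real k * ((K * s)\<^sup>2 / (2 + K * s)))) \<le> real n powr (- \<alpha> - 1)"
      using n by (simp add: powr_def algebra_simps)
    then have "real n * exp (- (real k * ((K * s)\<^sup>2 / (2 + K * s)))) \<le> real n * real n powr (- \<alpha> - 1)"
      by (intro mult_left_mono) auto
    also have "\<dots> = real n powr (- \<alpha>)"
      using n by (simp add: powr_diff)
    finally show "1 - 2 * real n powr (- \<alpha>)
        \<le> 1 - 2 * real n * exp (- (real k * ((K * s)\<^sup>2 / (2 + K * s))))"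
      by simp
  qed
  then show ?thesis
    by (simp add: s_def r_def)
qed

theorem theorem7:
  shows "(\<forall>(M :: 'w measure) (n :: nat) (g :: nat) (k :: nat) (p :: nat \<Rightarrow> real) T (\<epsilon> :: real).
            1 \<le> k \<and> k \<le> g \<and> (\<forall>j<n. 0 < p j) \<and> poisson_bars M n g T \<and> 0 \<le> \<epsilon> \<and> \<epsilon> \<le> 1 \<longrightarrow>
            with_prob_at_least M (1 - 2 * real n * exp (- (\<epsilon>\<^sup>2 * real k / 7)))
              (etc_competitive n p g k T (1 + 3 * \<epsilon> + 4 * (real k / real g))))
       \<and> (\<forall>\<alpha> :: real. \<alpha> > 0 \<longrightarrow>
            (\<exists>C D :: real. \<forall>(M :: 'w measure) (n :: nat) (g :: nat) (k :: nat) (p :: nat \<Rightarrow> real) T.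
               1 \<le> n \<and> 1 \<le> g \<and> (\<forall>j<n. 0 < p j) \<and> poisson_bars M n g T \<and>
               sqrt (\<alpha> * ln (real n)) / real g powr (1 / 3) < 1 \<and>
               (int k = \<lfloor>real g powr (2 / 3)\<rfloor> \<or> int k = \<lceil>real g powr (2 / 3)\<rceil>) \<longrightarrow>
               with_prob_at_least M (1 - D * real n powr (- \<alpha>))
                 (etc_competitive n p g k T
                    (1 + C * (sqrt (\<alpha> * ln (real n)) / real g powr (1 / 3))))))"
  by (intro conjI allI impI; (elim conjE)?)
    (blast intro: etc_competitive_fixed_accuracy etc_competitive_high_prob)+

end
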